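(* Let $n\ge 1$ be an integer, $T>0$, $\delta\in(0,1)$, let $\mathcal{D}=\{(t_0,\dots,t_n)\in\mathbb{R}^{n+1}: t_0=0,\ t_n=T,\ 0\le t_i\le T,\ t_i\le t_{i+1}\text{ for all }i\}$ and $L(t_0,\dots,t_n)=\sum_{0\le j<i\le n}\delta^{t_i-t_j}$. Then $L$ admits a unique minimum in $\mathcal{D}$. *)

theory Defs
  imports Complex_Main "HOL-Library.FuncSet"
begin

text \<open>
  A point of $\mathbb{R}^{n+1}$ is a function on the indices \<open>{0..n}\<close>; requiring it to be
  \<open>extensional\<close> fixes its values outside \<open>{0..n}\<close>, so that equality of points is equality of
  their $n+1$ coordinates.
\<close>

definition D_set :: "nat \<Rightarrow> real \<Rightarrow> (nat \<Rightarrow> real) set" where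
  "D_set n T = {t \<in> extensional {0..n}.
     t 0 = 0 \<and> t n = T \<and> (\<forall>i\<le>n. 0 \<le> t i \<and> t i \<le> T) \<and> (\<forall>i<n. t i \<le> t (i + 1))}"

definition L_fun :: "real \<Rightarrow> nat \<Rightarrow> (nat \<Rightarrow> real) \<Rightarrow> real" where
  "L_fun \<delta> n t = (\<Sum>(i, j) \<in> {(i, j). j < i \<and> i \<le> n}. \<delta> powr (t i - t j))"

end

theory Submission
  imports Defs "HOL-Analysis.Analysis"
begin

text \<open>
  The set \<open>D_set n T\<close> is a closed subset of a product of compact sets, and \<open>L_fun\<close> is continuous,
  so a minimiser exists. It is unique because \<open>L_fun\<close> is strictly midpoint convex: every summand is
  convex, being an exponential of a linear form, and two points of \<open>D_set n T\<close> that differ in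
  coordinate \<open>i\<close> have different values of \<open>t i - t 0\<close>.
\<close>

text \<open>With \<open>u = a powr (x / 2)\<close> and \<open>v = a powr (y / 2)\<close> this is
  \<open>(u - v)\<^sup>2\<close> expanded, since the power at the midpoint is \<open>u * v\<close>.
  The convexity defect is thus an explicit square, which yields both the weak and the strict
  inequality.\<close>

lemma powr_midpoint:
  fixes a x y :: real
  assumes "a > 0"
  shows "a powr x + a powr y = 2 * a powr ((x + y) / 2) + (a powr (x / 2) - a powr (y / 2))\<^sup>2"
proof -
  have "(a powr (z / 2))\<^sup>2 = a powr z" for z
    using powr_add[of a "z / 2" "z / 2"] by (simp add: power2_eq_square)
  moreover have "a powr ((x + y) / 2) = a powr (x / 2) * a powr (y / 2)"
    by (simp add: powr_add add_divide_distrib)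
  ultimately show ?thesis
    by (simp add: power2_diff)
qed

lemma powr_midpoint_le:
  fixes a x y :: real
  assumes "a > 0"
  shows "2 * a powr ((x + y) / 2) \<le> a powr x + a powr y"
  using powr_midpoint[OF assms, of x y] by simp

lemma powr_midpoint_less:
  fixes a x y :: real
  assumes "a > 0" "a \<noteq> 1" "x \<noteq> y"
  shows "2 * a powr ((x + y) / 2) < a powr x + a powr y"
proof -
  have "a powr (x / 2) \<noteq> a powr (y / 2)"
    using assms powr_inj[of a "x / 2" "y / 2"] by simp
  then show ?thesis
    using powr_midpoint[OF assms(1), of x y] by simp
qed

lemma finite_index_pairs: "finite {(i, j). j < i \<and> i \<le> (n::nat)}"
  by (rule finite_subset[of _ "{..n} \<times> {..n}"]) auto

lemma compact_D_set: "compact (D_set n T)"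
proof -
  \<comment> \<open>The factor \<open>{undefined}\<close> beyond index \<open>n\<close> encodes
    membership in \<open>extensional {0..n}\<close> and keeps every factor of the infinite product
    compact, so that Tychonoff applies.\<close>
  define B where "B i = (if i \<le> n then {0..T} else {undefined})" for i :: nat
  have "compactin (product_topology (\<lambda>i. euclidean) UNIV) (PiE UNIV B)"
    by (simp add: compactin_PiE B_def)
  then have B: "compact (PiE UNIV B)"
    by (simp add: euclidean_product_topology)
  have "closed {t :: nat \<Rightarrow> real. t 0 = 0 \<and> t n = T \<and> (\<forall>i<n. t i \<le> t (i + 1))}"
    by (intro closed_Collect_conj closed_Collect_all closed_Collect_imp closed_Collect_eq
        closed_Collect_le continuous_on_product_coordinates continuous_on_const) auto
  moreover have "D_set n T =
      PiE UNIV B \<inter> {t. t 0 = 0 \<and> t n = T \<and> (\<forall>i<n. t i \<le> t (i + 1))}"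
    by (auto simp: D_set_def B_def PiE_iff extensional_def split: if_splits)
  ultimately show ?thesis
    using B by (simp add: compact_Int_closed)
qed

lemma continuous_on_L_fun:
  assumes "\<delta> > 0"
  shows "continuous_on S (L_fun \<delta> n)"
proof -
  have "continuous_on UNIV (L_fun \<delta> n)"
    unfolding L_fun_def case_prod_beta using assms
    by (intro continuous_on_sum continuous_on_powr continuous_on_diff continuous_on_const
        continuous_on_product_coordinates) auto
  then show ?thesis
    by (rule continuous_on_subset) simp
qed

lemma D_set_nonempty:
  assumes "n \<ge> 1" "T \<ge> 0"
  shows "D_set n T \<noteq> {}"
proof -
  \<comment> \<open>The point (0, T, ..., T); its last coordinate is \<open>T\<close> rather than 0
    because \<open>n \<ge> 1\<close>.\<close>
  have "restrict (\<lambda>i. if i = 0 then 0 else T) {0..n} \<in> D_set n T"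
    using assms by (auto simp: D_set_def)
  then show ?thesis by blast
qed

lemma D_set_midpoint:
  assumes "s \<in> D_set n T" "t \<in> D_set n T"
  shows "restrict (\<lambda>i. (s i + t i) / 2) {0..n} \<in> D_set n T"
proof -
  have "s i + t i \<le> T * 2" if "i \<le> n" for i
    using assms that by (fastforce simp: D_set_def)
  then show ?thesis
    using assms by (auto simp: D_set_def intro: add_mono)
qed

lemma L_fun_midpoint_less:
  assumes "0 < \<delta>" "\<delta> \<noteq> 1" "s \<in> D_set n T" "t \<in> D_set n T" "s \<noteq> t"
  shows "2 * L_fun \<delta> n (restrict (\<lambda>i. (s i + t i) / 2) {0..n}) < L_fun \<delta> n s + L_fun \<delta> n t"
proof -
  define m where "m = restrict (\<lambda>i. (s i + t i) / 2) {0..n}"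
  have m: "m i - m j = ((s i - s j) + (t i - t j)) / 2" if "j < i" "i \<le> n" for i j
    using that by (simp add: m_def field_simps)
  \<comment> \<open>Both points are extensional, so they must differ at an index in
    \<open>{0..n}\<close>.\<close>
  obtain k where k: "k \<le> n" "s k \<noteq> t k"
    using assms(3-5) by (metis (no_types, lifting) D_set_def atLeastAtMost_iff extensionalityI
        mem_Collect_eq)
  have zero: "s 0 = 0" "t 0 = 0"
    using assms(3,4) by (auto simp: D_set_def)
  with k have "0 < k"
    by (metis gr0I)
  have "(\<Sum>(i, j) \<in> {(i, j). j < i \<and> i \<le> n}. 2 * \<delta> powr (m i - m j))
      < (\<Sum>(i, j) \<in> {(i, j). j < i \<and> i \<le> n}. \<delta> powr (s i - s j) + \<delta> powr (t i - t j))"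
  \<comment> \<open>One strict summand suffices. The pair \<open>(k, 0)\<close> provides it:
    coordinate 0 vanishes in both points, so the exponents are \<open>s k\<close> and
    \<open>t k\<close>, which differ.\<close>
  proof (rule sum_strict_mono_ex1[OF finite_index_pairs])
    show "\<exists>p\<in>{(i, j). j < i \<and> i \<le> n}. (case p of (i, j) \<Rightarrow> 2 * \<delta> powr (m i - m j))
        < (case p of (i, j) \<Rightarrow> \<delta> powr (s i - s j) + \<delta> powr (t i - t j))"
      using k \<open>0 < k\<close> zero powr_midpoint_less[OF assms(1,2) k(2)]
      by (intro bexI[of _ "(k, 0)"]) (auto simp: m)
  qed (auto simp: m intro: powr_midpoint_le[OF assms(1)])
  then show ?thesis
    by (simp add: L_fun_def m_def sum_distrib_left sum.distrib case_prod_beta)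
qed

theorem theorem1:
  fixes n :: nat and T \<delta> :: real
  assumes "n \<ge> 1" and "T > 0" and "0 < \<delta>" and "\<delta> < 1"
  shows "\<exists>!t. t \<in> D_set n T \<and> (\<forall>s \<in> D_set n T. L_fun \<delta> n t \<le> L_fun \<delta> n s)"
proof (rule ex_ex1I)
  show "\<exists>t. t \<in> D_set n T \<and> (\<forall>s \<in> D_set n T. L_fun \<delta> n t \<le> L_fun \<delta> n s)"
    using continuous_attains_inf[OF compact_D_set D_set_nonempty continuous_on_L_fun] assms
    by (simp add: Bex_def)
next
  fix s t
  assume s: "s \<in> D_set n T \<and> (\<forall>u \<in> D_set n T. L_fun \<delta> n s \<le> L_fun \<delta> n u)"
    and t: "t \<in> D_set n T \<and> (\<forall>u \<in> D_set n T. L_fun \<delta> n t \<le> L_fun \<delta> n u)"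
  show "s = t"
  proof (rule ccontr)
    assume "s \<noteq> t"
    \<comment> \<open>Both points attain the minimum, so their midpoint, which lies in
      \<open>D_set n T\<close>, would have a value below it.\<close>
    then have "2 * L_fun \<delta> n (restrict (\<lambda>i. (s i + t i) / 2) {0..n}) < L_fun \<delta> n s + L_fun \<delta> n t"
      using s t assms by (intro L_fun_midpoint_less) auto
    moreover have "restrict (\<lambda>i. (s i + t i) / 2) {0..n} \<in> D_set n T"
      using D_set_midpoint s t by blast
    ultimately show False
      using s t by fastforce
  qed
qed

end
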